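(* Let $f:\mathbb{R}^p\to\mathbb{R}$ be smooth (continuously differentiable), let $\theta:\mathbb{R}^p\to]-\infty,\infty]$ be proper and lower semicontinuous, let $\kappa$ be a positive integer, let $\Omega:=\{x\in\mathbb{R}^p:\ \|x\|_0\le\kappa\}$, let $h:=\delta_{\Omega}$ be the indicator function of $\Omega$, and let $\Theta:=f+\theta+h$. Suppose that the following conditions hold: (i) $\theta$ is continuous relative to the set ${\rm dom}\,\partial\theta$; (ii) $\theta$ is regular at every point of ${\rm dom}\,\partial\theta$; (iii) for every $x\in{\rm dom}\,\partial\theta$, $\partial(\theta+h)(x)\subseteq\partial\theta(x)+\partial h(x)$; (iv) for every $I\subseteq\{1,\ldots,p\}$, the function $g_I:=f_I+\theta_I$ is a KL function of exponent $1/2$, where $f_I(z):=f(E_Iz)$ and $\theta_I(z):=\theta(E_Iz)$ for $z\in\mathbb{R}^{|I|}$. Then $\Theta$ has the KL property of exponent $1/2$ at every critical point of $\Theta$.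
   Context: $\|x\|_0$ denotes the number of nonzero entries of $x$. The indicator function $\delta_\Omega$ is $0$ on $\Omega$ and $+\infty$ elsewhere. $E$ is the $p\times p$ identity matrix and $E_I$ is the $p\times|I|$ matrix consisting of the columns of $E$ indexed by $I$, so that $E_Iz$ is the vector of $\mathbb{R}^p$ whose entries on $I$ are given by $z$ and which is zero off $I$. Subdifferentials. For $\phi:\mathbb{R}^p\to]-\infty,\infty]$ and $x\in{\rm dom}\,\phi:=\{x:\phi(x)<\infty\}$, the regular subdifferential $\widehat{\partial}\phi(x)$ is the set of $v\in\mathbb{R}^p$ with $\liminf_{x'\to x,\,x'\neq x}\frac{\phi(x')-\phi(x)-\langle v,x'-x\rangle}{\|x'-x\|}\ge 0$. The (limiting) subdifferential $\partial\phi(x)$ is the set of all $v$ for which there are $x^k\to x$ with $\phi(x^k)\to\phi(x)$ and $v^k\in\widehat{\partial}\phi(x^k)$ with $v^k\to v$. For $x\notin{\rm dom}\,\phi$ these sets are empty. ${\rm dom}\,\partial\phi:=\{x:\partial\phi(x)\neq\emptyset\}$. A critical point of $\phi$ is a point $\overline{x}$ with $0\in\partial\phi(\overline{x})$. Regularity of a function at a point is subdifferential (Clarke) regularity in the sense of Rockafellar and Wets, i.e. the epigraph is Clarke regular at the corresponding point. KL property of exponent $1/2$. A function $\phi:\mathbb{R}^m\to]-\infty,\infty]$ has the Kurdyka-Łojasiewicz (KL) property of exponent $1/2$ at $\overline{x}\in{\rm dom}\,\partial\phi$ if there exist $c>0$, $\eta\in]0,\infty]$ and a neighborhood $\mathcal{U}$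 of $\overline{x}$ such that, with $\varphi(s)=c\sqrt{s}$, $\varphi'(\phi(x)-\phi(\overline{x}))\,{\rm dist}(0,\partial\phi(x))\ge 1$ for all $x\in\mathcal{U}$ with $\phi(\overline{x})<\phi(x)<\phi(\overline{x})+\eta$, where ${\rm dist}(0,\emptyset)=\infty$. It is a KL function of exponent $1/2$ if it has this property at each point of ${\rm dom}\,\partial\phi$ (a vacuous condition if $\phi\equiv\infty$). *)

theory Defs
  imports "HOL-Analysis.Analysis"
begin

text \<open>Functions into \<open>]-\<infinity>, \<infinity>]\<close> are \<^typ>\<open>ereal\<close>-valued functions that avoid \<open>-\<infinity>\<close>. The variational notions
  take the domain space \<open>S\<close> as a parameter: \<open>S\<close> is a linear subspace of a Euclidean space, regarded
  as a Euclidean space in its own right, so that test points, subgradients and neighbourhoods are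
  all taken inside \<open>S\<close>. For \<open>S = UNIV\<close> these are the usual notions; proper subspaces are needed
  because \<open>\<real>\<close> to the power \<open>|I|\<close>, with \<open>I\<close> bound inside a formula, is not a type.\<close>

definition regular_subdiff_on ::
  "'a::euclidean_space set \<Rightarrow> ('a \<Rightarrow> ereal) \<Rightarrow> 'a \<Rightarrow> 'a set" where
  "regular_subdiff_on S \<phi> x =
     {v. x \<in> S \<and> \<phi> x < \<infinity> \<and> v \<in> S \<and>
         Liminf (at x within S)
           (\<lambda>x'. (\<phi> x' - \<phi> x - ereal (inner v (x' - x))) / ereal (norm (x' - x))) \<ge> 0}"

definition subdiff_on ::
  "'a::euclidean_space set \<Rightarrow> ('a \<Rightarrow> ereal) \<Rightarrow> 'a \<Rightarrow> 'a set" where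
  "subdiff_on S \<phi> x =
     {v. x \<in> S \<and> \<phi> x < \<infinity> \<and>
         (\<exists>xs vs. xs \<longlonglongrightarrow> x \<and> (\<lambda>k. \<phi> (xs k)) \<longlonglongrightarrow> \<phi> x \<and>
                  (\<forall>k. vs k \<in> regular_subdiff_on S \<phi> (xs k)) \<and> vs \<longlonglongrightarrow> v)}"

definition dom_subdiff_on :: "'a::euclidean_space set \<Rightarrow> ('a \<Rightarrow> ereal) \<Rightarrow> 'a set" where
  "dom_subdiff_on S \<phi> = {x. subdiff_on S \<phi> x \<noteq> {}}"

abbreviation subdiff :: "('a::euclidean_space \<Rightarrow> ereal) \<Rightarrow> 'a \<Rightarrow> 'a set" where
  "subdiff \<equiv> subdiff_on UNIV"

abbreviation dom_subdiff :: "('a::euclidean_space \<Rightarrow> ereal) \<Rightarrow> 'a set" where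
  "dom_subdiff \<equiv> dom_subdiff_on UNIV"

definition critical_point :: "('a::euclidean_space \<Rightarrow> ereal) \<Rightarrow> 'a \<Rightarrow> bool" where
  "critical_point \<phi> x \<longleftrightarrow> 0 \<in> subdiff \<phi> x"

text \<open>The infimum is taken in \<^typ>\<open>ereal\<close>, so that the distance to the empty set is \<open>\<infinity>\<close>
  (unlike \<^const>\<open>infdist\<close>, which is then \<open>0\<close>).\<close>

definition edist_to_set :: "'a::metric_space \<Rightarrow> 'a set \<Rightarrow> ereal" where
  "edist_to_set x A = (INF a\<in>A. ereal (dist x a))"

definition KL_half_at ::
  "'a::euclidean_space set \<Rightarrow> ('a \<Rightarrow> ereal) \<Rightarrow> 'a \<Rightarrow> bool" where
  "KL_half_at S \<phi> xbar \<longleftrightarrow>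
     xbar \<in> dom_subdiff_on S \<phi> \<and>
     (\<exists>c::real. \<exists>\<eta>::ereal. \<exists>U. c > 0 \<and> \<eta> > 0 \<and> open U \<and> xbar \<in> U \<and>
        (\<forall>x \<in> S \<inter> U. \<phi> xbar < \<phi> x \<and> \<phi> x < \<phi> xbar + \<eta> \<longrightarrow>
           ereal (deriv (\<lambda>s. c * sqrt s) (real_of_ereal (\<phi> x - \<phi> xbar)))
             * edist_to_set 0 (subdiff_on S \<phi> x) \<ge> 1))"

definition KL_half_function :: "'a::euclidean_space set \<Rightarrow> ('a \<Rightarrow> ereal) \<Rightarrow> bool" where
  "KL_half_function S \<phi> \<longleftrightarrow> (\<forall>x \<in> dom_subdiff_on S \<phi>. KL_half_at S \<phi> x)"

text \<open>Normal cones, Clarke regularity of sets and subdifferential regularity of functions, as in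
  Rockafellar and Wets, Variational Analysis, Definitions 6.3, 6.4 and 7.25.\<close>

definition regular_normal_cone :: "'a::euclidean_space set \<Rightarrow> 'a \<Rightarrow> 'a set" where
  "regular_normal_cone C x =
     {v. x \<in> C \<and>
         Limsup (at x within C) (\<lambda>x'. ereal (inner v (x' - x) / norm (x' - x))) \<le> 0}"

definition normal_cone :: "'a::euclidean_space set \<Rightarrow> 'a \<Rightarrow> 'a set" where
  "normal_cone C x =
     {v. x \<in> C \<and>
         (\<exists>xs vs. xs \<longlonglongrightarrow> x \<and> (\<forall>k. vs k \<in> regular_normal_cone C (xs k)) \<and> vs \<longlonglongrightarrow> v)}"

definition locally_closed_at :: "'a::euclidean_space set \<Rightarrow> 'a \<Rightarrow> bool" where
  "locally_closed_at C x \<longleftrightarrow> (\<exists>V. closed V \<and> x \<in> interior V \<and> closed (C \<inter> V))"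

definition Clarke_regular_at :: "'a::euclidean_space set \<Rightarrow> 'a \<Rightarrow> bool" where
  "Clarke_regular_at C x \<longleftrightarrow>
     x \<in> C \<and> locally_closed_at C x \<and> normal_cone C x = regular_normal_cone C x"

definition ereal_epigraph :: "('a \<Rightarrow> ereal) \<Rightarrow> ('a \<times> real) set" where
  "ereal_epigraph \<phi> = {(x, a). \<phi> x \<le> ereal a}"

definition regular_at :: "('a::euclidean_space \<Rightarrow> ereal) \<Rightarrow> 'a \<Rightarrow> bool" where
  "regular_at \<phi> x \<longleftrightarrow>
     \<bar>\<phi> x\<bar> \<noteq> \<infinity> \<and> Clarke_regular_at (ereal_epigraph \<phi>) (x, real_of_ereal (\<phi> x))"

definition proper :: "('a \<Rightarrow> ereal) \<Rightarrow> bool" where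
  "proper \<phi> \<longleftrightarrow> (\<forall>x. \<phi> x \<noteq> -\<infinity>) \<and> (\<exists>x. \<phi> x < \<infinity>)"

definition lower_semicontinuous :: "('a::topological_space \<Rightarrow> ereal) \<Rightarrow> bool" where
  "lower_semicontinuous \<phi> \<longleftrightarrow> (\<forall>x. \<phi> x \<le> Liminf (at x) \<phi>)"

definition continuously_differentiable :: "('a::real_inner \<Rightarrow> real) \<Rightarrow> bool" where
  "continuously_differentiable f \<longleftrightarrow>
     (\<exists>grad. (\<forall>x. GDERIV f x :> grad x) \<and> continuous_on UNIV grad)"

definition indicator_fun :: "'a set \<Rightarrow> 'a \<Rightarrow> ereal" where
  "indicator_fun A x = (if x \<in> A then 0 else \<infinity>)"

definition l0 :: "real ^ 'n::finite \<Rightarrow> nat" where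
  "l0 x = card {i. x $ i \<noteq> 0}"

text \<open>The space of real vectors indexed by \<open>I\<close> (the domain of \<open>E\<^sub>I\<close>) is realised isometrically inside
  \<open>\<real>\<close> to the power \<open>p\<close>, a vector \<open>(z\<^sub>i)\<close> with \<open>i \<in> I\<close> being stored with zeros outside \<open>I\<close>; this also
  covers \<open>I = {}\<close>, where it is \<open>{0}\<close>. Under this encoding \<open>E\<^sub>I\<close> becomes the inclusion.\<close>

definition coord_space :: "'n::finite set \<Rightarrow> (real ^ 'n) set" where
  "coord_space I = {z. \<forall>i. i \<notin> I \<longrightarrow> z $ i = 0}"

definition embed_coord :: "'n::finite set \<Rightarrow> real ^ 'n \<Rightarrow> real ^ 'n" where
  "embed_coord I z = (\<chi> i. if i \<in> I then z $ i else 0)"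

lemma embed_coord_on_coord_space: "z \<in> coord_space I \<Longrightarrow> embed_coord I z = z"
  by (auto simp: embed_coord_def coord_space_def vec_eq_iff)

lemma subspace_coord_space: "subspace (coord_space I)"
  by (auto simp: coord_space_def subspace_def)

lemma dim_coord_space: "dim (coord_space I) = card I"
  using dim_substandard_cart[of I, where 'a=real] by (simp add: coord_space_def dim_vec_eq)

end

theory Submission
  imports Defs
begin

text \<open>A subgradient \<open>v\<close> of \<open>\<Theta>\<close> at \<open>x\<close> is a limit of regular subgradients at points whose supports may be
  taken to be one fixed set \<open>J\<close> with \<open>|J| \<le> \<kappa>\<close>. As \<open>\<Theta>\<close> and \<open>g\<^sub>J\<close> agree on the coordinate space of
  \<open>J\<close>, the orthogonal projection of \<open>v\<close> to that space is a subgradient of \<open>g\<^sub>J\<close> at \<open>x\<close>, and it is no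
  longer than \<open>v\<close>. So the KL inequalities of the finitely many \<open>g\<^sub>J\<close> at a point give the one of
  \<open>\<Theta>\<close>. They hold also if the point is outside the domain of \<open>\<partial>g\<^sub>J\<close>, since
  subgradients of \<open>g\<^sub>J\<close> at nearby points with nearby values are then bounded away from \<open>0\<close>.\<close>

section \<open>Limiting subgradients as points of a closure\<close>

definition subgradient_graph ::
  "'a::euclidean_space set \<Rightarrow> ('a \<Rightarrow> ereal) \<Rightarrow> ('a \<times> ereal \<times> 'a) set" where
  "subgradient_graph S \<phi> = {(x, \<phi> x, v) | x v. v \<in> regular_subdiff_on S \<phi> x}"

text \<open>Since the triples carry the value \<open>\<phi> x\<close> as their middle entry,
  convergence in the product topology includes the required convergence of the function values. The
  sequences in the definition of a limiting subgradient are then sequences in the graph, and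
  topological facts about closures become available.\<close>

lemma mem_subdiff_on_iff:
  "v \<in> subdiff_on S \<phi> x \<longleftrightarrow>
    x \<in> S \<and> \<phi> x < \<infinity> \<and> (x, \<phi> x, v) \<in> closure (subgradient_graph S \<phi>)"
proof -
  have "(\<exists>xs vs. xs \<longlonglongrightarrow> x \<and> (\<lambda>k. \<phi> (xs k)) \<longlonglongrightarrow> \<phi> x \<and>
          (\<forall>k. vs k \<in> regular_subdiff_on S \<phi> (xs k)) \<and> vs \<longlonglongrightarrow> v) \<longleftrightarrow>
        (\<exists>s. (\<forall>k. s k \<in> subgradient_graph S \<phi>) \<and> s \<longlonglongrightarrow> (x, \<phi> x, v))" (is "?L \<longleftrightarrow> ?R")
  proof
    assume ?L
    then obtain xs vs where *: "xs \<longlonglongrightarrow> x" "(\<lambda>k. \<phi> (xs k)) \<longlonglongrightarrow> \<phi> x"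
      "\<forall>k. vs k \<in> regular_subdiff_on S \<phi> (xs k)" "vs \<longlonglongrightarrow> v" by blast
    have "(\<lambda>k. (xs k, \<phi> (xs k), vs k)) \<longlonglongrightarrow> (x, \<phi> x, v)"
      using * by (intro tendsto_Pair)
    moreover have "\<forall>k. (xs k, \<phi> (xs k), vs k) \<in> subgradient_graph S \<phi>"
      using * by (auto simp: subgradient_graph_def)
    ultimately show ?R by (intro exI[of _ "\<lambda>k. (xs k, \<phi> (xs k), vs k)"]) simp
  next
    assume ?R
    then obtain s where s: "\<forall>k. s k \<in> subgradient_graph S \<phi>" "s \<longlonglongrightarrow> (x, \<phi> x, v)" by blast
    have 1: "(\<lambda>k. fst (s k)) \<longlonglongrightarrow> x" using tendsto_fst[OF s(2)] by simp
    have 2: "(\<lambda>k. fst (snd (s k))) \<longlonglongrightarrow> \<phi> x"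
      using tendsto_fst[OF tendsto_snd[OF s(2)]] by simp
    have 3: "(\<lambda>k. snd (snd (s k))) \<longlonglongrightarrow> v"
      using tendsto_snd[OF tendsto_snd[OF s(2)]] by simp
    have 4: "fst (snd (s k)) = \<phi> (fst (s k)) \<and>
        snd (snd (s k)) \<in> regular_subdiff_on S \<phi> (fst (s k))" for k
      using s(1)[rule_format, of k] by (auto simp: subgradient_graph_def)
    show ?L
      using 1 2 3 4
      by (intro exI[of _ "\<lambda>k. fst (s k)"] exI[of _ "\<lambda>k. snd (snd (s k))"]) simp
  qed
  then show ?thesis
    unfolding subdiff_on_def closure_sequential by simp
qed

section \<open>The KL inequality in real terms\<close>

lemma one_le_ereal_times_iff:
  assumes "d > 0"
  shows "1 \<le> ereal d * e \<longleftrightarrow> ereal (1 / d) \<le> e"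
  using assms by (cases e) (auto simp: field_simps one_ereal_def)

text \<open>The derivative is \<open>c / (2 * sqrt s)\<close>, and a lower bound on an infimum is a
  lower bound on each member. For empty \<open>A\<close> the distance is infinite and the right side
  is vacuous, so both sides hold.\<close>

lemma KL_half_inequality_iff:
  fixes A :: "'a::euclidean_space set"
  assumes "c > 0" "s > 0"
  shows "1 \<le> ereal (deriv (\<lambda>s. c * sqrt s) s) * edist_to_set 0 A \<longleftrightarrow>
    (\<forall>v\<in>A. 2 * sqrt s \<le> c * norm v)"
proof -
  have "((\<lambda>s. c * sqrt s) has_real_derivative c / (2 * sqrt s)) (at s)"
    using assms by (auto intro!: derivative_eq_intros simp: field_simps)
  then have "deriv (\<lambda>s. c * sqrt s) s = c / (2 * sqrt s)"
    by (rule DERIV_imp_deriv)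
  moreover have "c / (2 * sqrt s) > 0" using assms by simp
  ultimately have "1 \<le> ereal (deriv (\<lambda>s. c * sqrt s) s) * edist_to_set 0 A \<longleftrightarrow>
      ereal (1 / (c / (2 * sqrt s))) \<le> edist_to_set 0 A"
    by (simp only: one_le_ereal_times_iff)
  also have "\<dots> \<longleftrightarrow> (\<forall>v\<in>A. 1 / (c / (2 * sqrt s)) \<le> norm v)"
    by (simp add: edist_to_set_def le_INF_iff)
  also have "\<dots> \<longleftrightarrow> (\<forall>v\<in>A. 2 * sqrt s \<le> c * norm v)"
    using assms by (intro ball_cong refl) (simp add: field_simps)
  finally show ?thesis .
qed

text \<open>One real \<open>r\<close> bounds both the distance and the gap in value. Unlike
  \<open>KL_half_at\<close>, the estimate does not ask \<open>xbar\<close> to have a subgradient, so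
  it can be stated for every piece through \<open>xbar\<close>.\<close>

definition KL_half_estimate ::
  "'a::euclidean_space set \<Rightarrow> ('a \<Rightarrow> ereal) \<Rightarrow> 'a \<Rightarrow> real \<Rightarrow> real \<Rightarrow> bool" where
  "KL_half_estimate S \<phi> xbar c r \<longleftrightarrow>
    (\<forall>x\<in>S. dist xbar x < r \<longrightarrow> \<phi> xbar < \<phi> x \<longrightarrow> \<phi> x < \<phi> xbar + ereal r \<longrightarrow>
      (\<forall>v\<in>subdiff_on S \<phi> x. 2 * sqrt (real_of_ereal (\<phi> x - \<phi> xbar)) \<le> c * norm v))"

lemma KL_half_estimate_mono:
  assumes "KL_half_estimate S \<phi> xbar c r" "c \<le> c'" "r' \<le> r"
  shows "KL_half_estimate S \<phi> xbar c' r'"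
  unfolding KL_half_estimate_def
proof (intro ballI impI)
  fix x v
  assume x: "x \<in> S" "dist xbar x < r'" "\<phi> xbar < \<phi> x" "\<phi> x < \<phi> xbar + ereal r'"
    and v: "v \<in> subdiff_on S \<phi> x"
  have "\<phi> xbar + ereal r' \<le> \<phi> xbar + ereal r"
    using assms(3) by (intro add_left_mono) simp
  then have "2 * sqrt (real_of_ereal (\<phi> x - \<phi> xbar)) \<le> c * norm v"
    using assms(1,3) x v unfolding KL_half_estimate_def by force
  also have "\<dots> \<le> c' * norm v"
    using assms(2) by (simp add: mult_right_mono)
  finally show "2 * sqrt (real_of_ereal (\<phi> x - \<phi> xbar)) \<le> c' * norm v" .
qed

lemma KL_half_at_iff:
  assumes fin: "\<bar>\<phi> xbar\<bar> \<noteq> \<infinity>"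
  shows "KL_half_at S \<phi> xbar \<longleftrightarrow>
    xbar \<in> dom_subdiff_on S \<phi> \<and> (\<exists>c>0. \<exists>r>0. KL_half_estimate S \<phi> xbar c r)"
proof -
  obtain b where b: "\<phi> xbar = ereal b" using fin by auto
  have pos: "real_of_ereal (\<phi> x - \<phi> xbar) > 0"
    if "\<phi> xbar < \<phi> x" "\<phi> x < \<phi> xbar + e" for x e
    using that b by (cases "\<phi> x") auto
  have ineq: "1 \<le> ereal (deriv (\<lambda>s. c * sqrt s) (real_of_ereal (\<phi> x - \<phi> xbar)))
      * edist_to_set 0 (subdiff_on S \<phi> x) \<longleftrightarrow>
    (\<forall>v\<in>subdiff_on S \<phi> x. 2 * sqrt (real_of_ereal (\<phi> x - \<phi> xbar)) \<le> c * norm v)"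
    if "c > 0" "\<phi> xbar < \<phi> x" "\<phi> x < \<phi> xbar + e" for c x e
    using KL_half_inequality_iff that pos by blast
  show ?thesis
  proof (intro iffI conjI)
    assume "KL_half_at S \<phi> xbar"
    then obtain c \<eta> U where dom: "xbar \<in> dom_subdiff_on S \<phi>"
      and c: "c > 0" and \<eta>: "\<eta> > 0" and U: "open U" "xbar \<in> U"
      and KL: "\<forall>x \<in> S \<inter> U. \<phi> xbar < \<phi> x \<and> \<phi> x < \<phi> xbar + \<eta> \<longrightarrow>
           ereal (deriv (\<lambda>s. c * sqrt s) (real_of_ereal (\<phi> x - \<phi> xbar)))
             * edist_to_set 0 (subdiff_on S \<phi> x) \<ge> 1"
      unfolding KL_half_at_def by blast
    show "xbar \<in> dom_subdiff_on S \<phi>" by (rule dom)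
    obtain d where d: "d > 0" "ball xbar d \<subseteq> U"
      using U by (meson openE)
    \<comment> \<open>As \<open>\<eta>\<close> may be infinite, a positive real below it is
      chosen.\<close>
    obtain e where e: "e > 0" "ereal e \<le> \<eta>"
      using \<eta> by (metis ereal_dense2 ereal_less(2) less_imp_le)
    have "KL_half_estimate S \<phi> xbar c (min d e)"
      unfolding KL_half_estimate_def
    proof (intro ballI impI)
      fix x v
      assume x: "x \<in> S" "dist xbar x < min d e" "\<phi> xbar < \<phi> x"
          "\<phi> x < \<phi> xbar + ereal (min d e)"
        and v: "v \<in> subdiff_on S \<phi> x"
      have "\<phi> xbar + ereal (min d e) \<le> \<phi> xbar + \<eta>"
        using e by (intro add_left_mono) (meson dual_order.trans ereal_less_eq(3) min.cobounded2)
      then have lt: "\<phi> x < \<phi> xbar + \<eta>" using x by order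
      moreover have "x \<in> S \<inter> U" using x d by auto
      ultimately show "2 * sqrt (real_of_ereal (\<phi> x - \<phi> xbar)) \<le> c * norm v"
        using KL ineq[OF c x(3) lt] x(3) v by blast
    qed
    then show "\<exists>c>0. \<exists>r>0. KL_half_estimate S \<phi> xbar c r"
      using c d e by (meson min_less_iff_conj)
  next
    assume "xbar \<in> dom_subdiff_on S \<phi> \<and> (\<exists>c>0. \<exists>r>0. KL_half_estimate S \<phi> xbar c r)"
    then obtain c r where dom: "xbar \<in> dom_subdiff_on S \<phi>" and "c > 0" "r > 0"
      and est: "KL_half_estimate S \<phi> xbar c r" by blast
    have "1 \<le> ereal (deriv (\<lambda>s. c * sqrt s) (real_of_ereal (\<phi> x - \<phi> xbar)))
        * edist_to_set 0 (subdiff_on S \<phi> x)"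
      if "x \<in> S \<inter> ball xbar r" "\<phi> xbar < \<phi> x" "\<phi> x < \<phi> xbar + ereal r" for x
      using est that unfolding ineq[OF \<open>c > 0\<close> that(2,3)] KL_half_estimate_def by simp
    then show "KL_half_at S \<phi> xbar"
      unfolding KL_half_at_def using dom \<open>c > 0\<close> \<open>r > 0\<close>
      by (intro conjI exI[of _ c] exI[of _ "ereal r"] exI[of _ "ball xbar r"]) auto
  qed
qed

text \<open>The triple \<open>(xbar, \<phi> xbar, 0)\<close> lies outside a closed set, hence so
  does a product neighbourhood of it. Subgradients at nearby points with nearby values therefore
  have norm at least some \<open>e > 0\<close>, while the gap in value stays bounded. The case of no
  subgradient at \<open>xbar\<close> is included.\<close>

lemma KL_half_estimate_if_not_critical:
  assumes fin: "\<bar>\<phi> xbar\<bar> \<noteq> \<infinity>" and "xbar \<in> S" and 0: "0 \<notin> subdiff_on S \<phi> xbar"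
  shows "\<exists>c>0. \<exists>r>0. KL_half_estimate S \<phi> xbar c r"
proof -
  obtain b where b: "\<phi> xbar = ereal b" using fin by auto
  define G where "G = closure (subgradient_graph S \<phi>)"
  have "open (- G)" "(xbar, \<phi> xbar, 0) \<in> - G"
    using assms b by (auto simp: mem_subdiff_on_iff G_def)
  then obtain A B' where A: "open A" "xbar \<in> A" "open B'" "(\<phi> xbar, 0) \<in> B'" "A \<times> B' \<subseteq> - G"
    by (rule open_prod_elim) blast
  obtain B C where B: "open B" "\<phi> xbar \<in> B" "open C" "0 \<in> C" "B \<times> C \<subseteq> B'"
    using A(3,4) by (rule open_prod_elim) blast
  obtain d where d: "d > 0" "ball xbar d \<subseteq> A" using A by (meson openE)
  obtain e where e: "e > 0" "ball (0::'a) e \<subseteq> C" using B by (meson openE)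
  have "open (ereal -` B)" "b \<in> ereal -` B" using B b by (auto intro: open_ereal_vimage)
  then obtain r where r: "r > 0" "ball b r \<subseteq> ereal -` B" by (meson openE)
  \<comment> \<open>Here \<open>d\<close> controls the point and \<open>r\<close> the value. The
    bound 1 keeps the root of the gap at most 1, which is at most \<open>norm v / e\<close>; this
    explains the constant \<open>2 / e\<close>.\<close>
  define \<rho> where "\<rho> = min 1 (min d r)"
  have "KL_half_estimate S \<phi> xbar (2 / e) \<rho>"
    unfolding KL_half_estimate_def
  proof (intro ballI impI)
    fix x v
    assume x: "x \<in> S" "dist xbar x < \<rho>" "\<phi> xbar < \<phi> x" "\<phi> x < \<phi> xbar + ereal \<rho>"
      and v: "v \<in> subdiff_on S \<phi> x"
    obtain a where a: "\<phi> x = ereal a" "b < a" "a < b + \<rho>"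
      using x b by (cases "\<phi> x") auto
    have "\<phi> x \<in> B" using subsetD[OF r(2), of a] a by (simp add: \<rho>_def dist_real_def)
    moreover have "x \<in> A" using x d by (auto simp: \<rho>_def)
    moreover have "(x, \<phi> x, v) \<in> G" using v by (simp add: mem_subdiff_on_iff G_def)
    ultimately have "v \<notin> C" using A B by blast
    then have "e \<le> norm v" using e by (auto simp: subset_iff not_less)
    moreover have "sqrt (a - b) \<le> 1" using a by (simp add: \<rho>_def)
    moreover have "1 \<le> norm v / e" using e \<open>e \<le> norm v\<close> by simp
    ultimately have "sqrt (a - b) \<le> norm v / e" by linarith
    then show "2 * sqrt (real_of_ereal (\<phi> x - \<phi> xbar)) \<le> 2 / e * norm v"
      using a b by simp
  qed
  moreover have "\<rho> > 0" "2 / e > 0" using d e r by (auto simp: \<rho>_def)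
  ultimately show ?thesis by blast
qed

section \<open>Orthogonal projection of subgradients\<close>

definition orthogonal_projection ::
  "'a::euclidean_space set \<Rightarrow> ('a \<Rightarrow> 'a) \<Rightarrow> bool" where
  "orthogonal_projection S P \<longleftrightarrow>
    subspace S \<and> linear P \<and> range P \<subseteq> S \<and> (\<forall>v. \<forall>z\<in>S. inner (P v) z = inner v z)"

lemma norm_orthogonal_projection_le:
  assumes "orthogonal_projection S P"
  shows "norm (P v) \<le> norm v"
proof -
  have "norm (P v) * norm (P v) = inner v (P v)"
    using assms by (auto simp: orthogonal_projection_def norm_eq_sqrt_inner)
  also have "\<dots> \<le> norm v * norm (P v)" by (rule norm_cauchy_schwarz)
  finally show ?thesis by (metis mult_le_cancel_right norm_ge_zero norm_not_less_zero not_less order.trans)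
qed

text \<open>Restricting the test points to \<open>S\<close> preserves a lower bound on the lower
  limit. For these points \<open>x' - y\<close> lies in \<open>S\<close>, where \<open>v\<close> and
  \<open>P v\<close> have the same inner products, so the two difference quotients coincide.\<close>

lemma regular_subdiff_on_project:
  assumes P: "orthogonal_projection S P" and eq: "\<And>z. z \<in> S \<Longrightarrow> \<psi> z = \<phi> z"
    and y: "y \<in> S" and v: "v \<in> regular_subdiff_on UNIV \<phi> y"
  shows "P v \<in> regular_subdiff_on S \<psi> y"
proof -
  let ?q = "\<lambda>\<phi> v x'. (\<phi> x' - \<phi> y - ereal (inner v (x' - y))) / ereal (norm (x' - y))"
  have "0 \<le> Liminf (at y within S) (?q \<psi> (P v))"
    unfolding le_Liminf_iff
  proof (intro allI impI)
    fix t :: ereal assume "t < 0"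
    then have "\<forall>\<^sub>F x' in at y. t < ?q \<phi> v x'"
      using v unfolding regular_subdiff_on_def le_Liminf_iff by blast
    then have "\<forall>\<^sub>F x' in at y within S. t < ?q \<phi> v x'"
      by (metis at_le subset_UNIV filter_leD)
    moreover have "\<forall>\<^sub>F x' in at y within S. x' \<in> S"
      by (simp add: eventually_at_filter)
    ultimately show "\<forall>\<^sub>F x' in at y within S. t < ?q \<psi> (P v) x'"
    proof eventually_elim
      case (elim x')
      then have "inner (P v) (x' - y) = inner v (x' - y)"
        using P y by (simp add: orthogonal_projection_def subspace_diff)
      then show ?case using elim eq y by simp
    qed
  qed
  moreover have "\<psi> y < \<infinity>" using v eq[OF y] by (simp add: regular_subdiff_on_def)
  ultimately show ?thesis
    using y P by (auto simp: regular_subdiff_on_def orthogonal_projection_def)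
qed

section \<open>Functions whose domain lies in a finite union of subspaces\<close>

lemma closure_UN_finite:
  assumes "finite A"
  shows "closure (\<Union>i\<in>A. G i) = (\<Union>i\<in>A. closure (G i))"
  using assms by (induction A rule: finite_induct) simp_all

text \<open>The graph of regular subgradients splits into finitely many pieces according to the
  subspace that contains the base point. A limit point of the graph is a limit point of a single
  piece, and there the projection of regular subgradients passes to the limit.\<close>

lemma subdiff_project_finite_union:
  fixes S :: "'i \<Rightarrow> 'a::euclidean_space set"
  assumes fin: "finite A" and dom: "{x. \<phi> x < \<infinity>} \<subseteq> (\<Union>i\<in>A. S i)"
    and P: "\<And>i. i \<in> A \<Longrightarrow> orthogonal_projection (S i) (P i)"
    and eq: "\<And>i z. i \<in> A \<Longrightarrow> z \<in> S i \<Longrightarrow> \<psi> i z = \<phi> z"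
    and v: "v \<in> subdiff \<phi> x"
  shows "\<exists>i\<in>A. x \<in> S i \<and> P i v \<in> subdiff_on (S i) (\<psi> i) x"
proof -
  define G where "G i = subgradient_graph UNIV \<phi> \<inter> S i \<times> UNIV" for i
  have "subgradient_graph UNIV \<phi> = (\<Union>i\<in>A. G i)"
    using dom by (auto simp: G_def subgradient_graph_def regular_subdiff_on_def)
  then obtain i where i: "i \<in> A" and cl: "(x, \<phi> x, v) \<in> closure (G i)"
    using v closure_UN_finite[OF fin, of G] by (auto simp: mem_subdiff_on_iff)
  note Pi = P[OF i]
  have "G i \<subseteq> S i \<times> UNIV" by (auto simp: G_def)
  then have "closure (G i) \<subseteq> S i \<times> UNIV"
    using Pi by (intro closure_minimal closed_Times)
      (auto simp: orthogonal_projection_def closed_subspace)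
  then have x: "x \<in> S i" using cl by auto
  \<comment> \<open>\<open>T\<close> projects only the subgradient entry. It is continuous, so it
    maps the closure of the piece into the closure of the graph of \<open>\<psi> i\<close>.\<close>
  define T where "T = (\<lambda>(y :: 'a, a :: ereal, w). (y, a, P i w))"
  have "linear (P i)" using Pi by (simp add: orthogonal_projection_def)
  then have contP: "continuous_on UNIV (P i)"
    by (simp add: linear_continuous_on linear_conv_bounded_linear)
  have "continuous_on UNIV T"
    unfolding T_def case_prod_beta
    by (intro continuous_intros continuous_on_compose2[OF contP]) auto
  then have cont: "continuous_on (closure (G i)) T"
    by (rule continuous_on_subset) simp
  have "T ` G i \<subseteq> closure (subgradient_graph (S i) (\<psi> i))"
  proof
    fix p assume "p \<in> T ` G i"
    then obtain y w where y: "y \<in> S i" and w: "w \<in> regular_subdiff_on UNIV \<phi> y"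
      and p: "p = (y, \<phi> y, P i w)"
      by (auto simp: G_def T_def subgradient_graph_def)
    have "P i w \<in> regular_subdiff_on (S i) (\<psi> i) y"
      by (rule regular_subdiff_on_project[OF Pi eq[OF i] y w])
    then have "p \<in> subgradient_graph (S i) (\<psi> i)"
      using p eq[OF i y] by (auto simp: subgradient_graph_def)
    then show "p \<in> closure (subgradient_graph (S i) (\<psi> i))"
      using closure_subset by blast
  qed
  then have "T ` closure (G i) \<subseteq> closure (subgradient_graph (S i) (\<psi> i))"
    by (intro image_closure_subset[OF cont]) auto
  moreover have "T (x, \<phi> x, v) = (x, \<psi> i x, P i v)"
    using eq[OF i x] by (simp add: T_def)
  ultimately have "(x, \<psi> i x, P i v) \<in> closure (subgradient_graph (S i) (\<psi> i))"
    using cl by (metis imageI subsetD)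
  moreover have "\<psi> i x < \<infinity>" using v eq[OF i x] by (simp add: mem_subdiff_on_iff)
  ultimately show ?thesis using i x by (auto simp: mem_subdiff_on_iff)
qed

lemma KL_half_at_finite_union:
  fixes S :: "'i \<Rightarrow> 'a::euclidean_space set"
  assumes fin: "finite A" and dom: "{x. \<phi> x < \<infinity>} \<subseteq> (\<Union>i\<in>A. S i)"
    and P: "\<And>i. i \<in> A \<Longrightarrow> orthogonal_projection (S i) (P i)"
    and eq: "\<And>i z. i \<in> A \<Longrightarrow> z \<in> S i \<Longrightarrow> \<psi> i z = \<phi> z"
    and KL: "\<And>i. i \<in> A \<Longrightarrow> KL_half_function (S i) (\<psi> i)"
    and xbar: "xbar \<in> dom_subdiff \<phi>" "\<phi> xbar \<noteq> -\<infinity>"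
  shows "KL_half_at UNIV \<phi> xbar"
proof -
  have "\<phi> xbar < \<infinity>"
    using xbar by (auto simp: dom_subdiff_on_def mem_subdiff_on_iff)
  then have fin_xbar: "\<bar>\<phi> xbar\<bar> \<noteq> \<infinity>" using xbar by auto
  \<comment> \<open>Only the subspaces through \<open>xbar\<close> matter near
    \<open>xbar\<close>.\<close>
  define A' where "A' = {i \<in> A. xbar \<in> S i}"
  have "\<exists>c>0. \<exists>r>0. KL_half_estimate (S i) (\<psi> i) xbar c r" if "i \<in> A'" for i
  proof -
    have i: "i \<in> A" "xbar \<in> S i" and fi: "\<bar>\<psi> i xbar\<bar> \<noteq> \<infinity>"
      using that eq fin_xbar by (auto simp: A'_def)
    show ?thesis
    \<comment> \<open>A zero subgradient puts \<open>xbar\<close> in the domain where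
      \<open>KL\<close> applies; otherwise the bound away from zero gives the estimate.\<close>
    proof (cases "0 \<in> subdiff_on (S i) (\<psi> i) xbar")
      case True
      then have "KL_half_at (S i) (\<psi> i) xbar"
        using KL[OF i(1)] by (auto simp: KL_half_function_def dom_subdiff_on_def)
      then show ?thesis using KL_half_at_iff[of "\<psi> i", OF fi] by blast
    next
      case False
      then show ?thesis using KL_half_estimate_if_not_critical[of "\<psi> i", OF fi i(2)] by blast
    qed
  qed
  then obtain c r where cr: "\<And>i. i \<in> A' \<Longrightarrow> c i > 0 \<and> r i > 0 \<and>
      KL_half_estimate (S i) (\<psi> i) xbar (c i) (r i)"
    by metis
  \<comment> \<open>The finitely many subspaces that miss \<open>xbar\<close> form a closed union,
    so some ball around \<open>xbar\<close> avoids them all.\<close>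
  obtain d where d: "d > 0" "\<And>i. i \<in> A - A' \<Longrightarrow> ball xbar d \<inter> S i = {}"
  proof -
    have "closed (\<Union>i\<in>A - A'. S i)"
      using fin P by (intro closed_UN) (auto simp: orthogonal_projection_def closed_subspace)
    then have "open (- (\<Union>i\<in>A - A'. S i))" by (rule open_Compl)
    moreover have "xbar \<in> - (\<Union>i\<in>A - A'. S i)" by (auto simp: A'_def)
    ultimately obtain d where "d > 0" "ball xbar d \<subseteq> - (\<Union>i\<in>A - A'. S i)" by (meson openE)
    then show ?thesis using that[of d] by blast
  qed
  \<comment> \<open>The sum dominates each \<open>c i\<close> because all are positive. The summand
    1 here and the element \<open>d\<close> in \<open>R\<close> make both definitions work without
    showing \<open>A'\<close> nonempty.\<close>
  define C where "C = 1 + (\<Sum>i\<in>A'. c i)"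
  define R where "R = Min (insert d (r ` A'))"
  have finA': "finite A'" using fin by (simp add: A'_def)
  have C: "C > 0"
    unfolding C_def using cr by (intro add_pos_nonneg sum_nonneg) (auto simp: less_imp_le)
  have cC: "c i \<le> C" if "i \<in> A'" for i
    unfolding C_def using member_le_sum[of i A' c] that cr finA'
    by (force simp: less_imp_le)
  have R: "R > 0" "R \<le> d" "\<And>i. i \<in> A' \<Longrightarrow> R \<le> r i"
    using finA' cr d by (auto simp: R_def)
  have "KL_half_estimate UNIV \<phi> xbar C R"
    unfolding KL_half_estimate_def
  proof (intro ballI impI)
    fix x v
    assume x: "dist xbar x < R" "\<phi> xbar < \<phi> x" "\<phi> x < \<phi> xbar + ereal R"
      and v: "v \<in> subdiff \<phi> x"
    obtain i where i: "i \<in> A" "x \<in> S i" and Pv: "P i v \<in> subdiff_on (S i) (\<psi> i) x"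
      using subdiff_project_finite_union[where \<psi> = \<psi> and P = P, OF fin dom P eq v] by blast
    have i': "i \<in> A'" proof (rule ccontr)
      assume "i \<notin> A'"
      then have "x \<notin> ball xbar d" using d(2)[of i] i by blast
      then show False using x(1) R(2) by simp
    qed
    then have "xbar \<in> S i" by (simp add: A'_def)
    \<comment> \<open>Both endpoints of the gap have the same values under \<open>\<psi> i\<close>
      and \<open>\<phi>\<close>, so the estimate for \<open>\<psi> i\<close> speaks of the same gap;
      projecting \<open>v\<close> can only shorten it.\<close>
    then have eqs: "\<psi> i xbar = \<phi> xbar" "\<psi> i x = \<phi> x" using eq i by auto
    have "KL_half_estimate (S i) (\<psi> i) xbar C R"
      using cr[OF i'] cC[OF i'] R(3)[OF i'] KL_half_estimate_mono by blast
    then have "2 * sqrt (real_of_ereal (\<phi> x - \<phi> xbar)) \<le> C * norm (P i v)"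
      using i x Pv unfolding KL_half_estimate_def eqs by (metis eqs)
    also have "\<dots> \<le> C * norm v"
      using C norm_orthogonal_projection_le[OF P[OF i(1)]] by (simp add: mult_left_mono)
    finally show "2 * sqrt (real_of_ereal (\<phi> x - \<phi> xbar)) \<le> C * norm v" .
  qed
  then show ?thesis using KL_half_at_iff[of \<phi>, OF fin_xbar] C R xbar by blast
qed

section \<open>Coordinate spaces and the sparsity constraint\<close>

lemma orthogonal_projection_embed_coord:
  "orthogonal_projection (coord_space I) (embed_coord I)"
  unfolding orthogonal_projection_def
proof (intro conjI allI ballI)
  show "linear (embed_coord I)"
    by (rule linearI) (auto simp: embed_coord_def vec_eq_iff)
  show "range (embed_coord I) \<subseteq> coord_space I"
    by (auto simp: embed_coord_def coord_space_def)
  show "inner (embed_coord I v) z = inner v z" if "z \<in> coord_space I" for v z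
    using that by (auto simp: inner_vec_def embed_coord_def coord_space_def intro!: sum.cong)
qed (rule subspace_coord_space)

theorem theorem4p2:
  fixes f :: "real ^ 'p::finite \<Rightarrow> real"
    and \<theta> h \<Theta> :: "real ^ 'p \<Rightarrow> ereal"
    and \<kappa> :: nat
    and \<Omega> :: "(real ^ 'p) set"
  assumes f: "continuously_differentiable f"
    and \<theta>_proper: "proper \<theta>"
    and \<theta>_lsc: "lower_semicontinuous \<theta>"
    and \<kappa>: "\<kappa> > 0"
    and \<Omega>: "\<Omega> = {x. l0 x \<le> \<kappa>}"
    and h: "h = indicator_fun \<Omega>"
    and \<Theta>: "\<Theta> = (\<lambda>x. ereal (f x) + \<theta> x + h x)"
    and i: "continuous_on (dom_subdiff \<theta>) \<theta>"
    and ii: "\<forall>x \<in> dom_subdiff \<theta>. regular_at \<theta> x"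
    and iii: "\<forall>x \<in> dom_subdiff \<theta>.
                subdiff (\<lambda>y. \<theta> y + h y) x \<subseteq> {u + w | u w. u \<in> subdiff \<theta> x \<and> w \<in> subdiff h x}"
    and iv: "\<forall>I :: 'p set.
                KL_half_function (coord_space I)
                  (\<lambda>z. ereal (f (embed_coord I z)) + \<theta> (embed_coord I z))"
  shows "\<forall>xbar. critical_point \<Theta> xbar \<longrightarrow> KL_half_at UNIV \<Theta> xbar"
proof (intro allI impI)
  fix xbar
  assume "critical_point \<Theta> xbar"
  then have xbar: "xbar \<in> dom_subdiff \<Theta>"
    by (auto simp: critical_point_def dom_subdiff_on_def)
  define g where "g I z = ereal (f (embed_coord I z)) + \<theta> (embed_coord I z)" for I z
  \<comment> \<open>The coordinate spaces of these index sets make up \<open>\<Omega>\<close>: the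
    support of a point of \<open>\<Omega>\<close> is such a set, and vectors supported in such a set
    are in \<open>\<Omega>\<close>.\<close>
  define A where "A = {I :: 'p set. card I \<le> \<kappa>}"
  have dom: "{x. \<Theta> x < \<infinity>} \<subseteq> (\<Union>I\<in>A. coord_space I)"
  proof
    fix x assume "x \<in> {x. \<Theta> x < \<infinity>}"
    then have "x \<in> \<Omega>" by (auto simp: \<Theta> h indicator_fun_def split: if_splits)
    then have "{i. x $ i \<noteq> 0} \<in> A" by (simp add: A_def \<Omega> l0_def)
    moreover have "x \<in> coord_space {i. x $ i \<noteq> 0}" by (simp add: coord_space_def)
    ultimately show "x \<in> (\<Union>I\<in>A. coord_space I)" by blast
  qed
  \<comment> \<open>On these spaces the indicator \<open>h\<close> vanishes and
    \<open>embed_coord I\<close> is the identity.\<close>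
  have eq: "g I z = \<Theta> z" if "I \<in> A" "z \<in> coord_space I" for I z
  proof -
    have "{i. z $ i \<noteq> 0} \<subseteq> I" using that by (auto simp: coord_space_def)
    then have "l0 z \<le> card I" by (simp add: l0_def card_mono)
    then have "z \<in> \<Omega>" using that by (simp add: \<Omega> A_def)
    then show ?thesis
      using that by (simp add: g_def \<Theta> h indicator_fun_def embed_coord_on_coord_space)
  qed
  have "\<Theta> xbar \<noteq> -\<infinity>"
    using \<theta>_proper by (auto simp: \<Theta> h indicator_fun_def proper_def)
  moreover have "KL_half_function (coord_space I) (g I)" for I
    using iv unfolding g_def by blast
  ultimately show "KL_half_at UNIV \<Theta> xbar"
    using xbar orthogonal_projection_embed_coord eq dom
    by (intro KL_half_at_finite_union[where A = A and S = coord_space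
          and P = embed_coord and \<psi> = g]) auto
qed

end
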